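(* Let $K$ be a field, and let $\mathcal{A}=\{v_1,\ldots,v_q\}$ be the set of column vectors of an $n\times q$ matrix $A$ with entries in $\mathbb{N}$ all of whose rows and columns are nonzero. If the system $xA\leq\mathbf{1}$ has the integer rounding property, then (a) $K[F]$ is normal, where $F=\{x^{v_1},\ldots,x^{v_q}\}$ and $K[F]=K[x^{v_1},\ldots,x^{v_q}]\subset K[x_1,\ldots,x_n]$, and (b) $\mathbb{Z}^n/\mathbb{Z}\mathcal{A}$ is a torsion-free group. Conversely, if there is an integer $d$ with $|v_i|=d$ for all $i$ and both (a) and (b) hold, then the system $xA\leq\mathbf{1}$ has the integer rounding property.
   Context: $x^a:=x_1^{a_1}\cdots x_n^{a_n}$; $\mathbf{1}$ is the all-ones vector; $|v_i|=\langle v_i,\mathbf{1}\rangle$ is the sum of the entries of $v_i$; $\mathbb{Z}\mathcal{A}$ is the subgroup of $\mathbb{Z}^n$ generated by $\mathcal{A}$. Normal means integrally closed in its field of fractions. The system $xA\leq\mathbf{1}$ has the integer rounding property if $$\lceil\min\{\langle y,\mathbf{1}\rangle\mid y\in\mathbb{R}^q,\ y\geq 0;\ Ay=a\}\rceil=\min\{\langle y,\mathbf{1}\rangle\mid Ay=a;\ y\in\mathbb{N}^q\}$$ for each integral vector $a$ for which $\min\{\langle y,\mathbf{1}\rangle\mid y\geq 0;\ Ay=a\}$ is finite. *)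

theory Defs
  imports
    "HOL-Library.Poly_Mapping"
    "HOL-Computational_Algebra.Polynomial_Factorial"
    "HOL-Algebra.Generated_Groups"
    "HOL-Algebra.Coset"
    "Jordan_Normal_Form.Matrix"
begin

definition ones_vec :: "nat \<Rightarrow> 'a::one vec" where
  "ones_vec n = vec n (\<lambda>_. 1)"

definition is_minimum :: "'a::order set \<Rightarrow> 'a \<Rightarrow> bool" where
  "is_minimum S m \<longleftrightarrow> m \<in> S \<and> (\<forall>x\<in>S. m \<le> x)"

definition lp_values :: "nat mat \<Rightarrow> int vec \<Rightarrow> real set" where
  "lp_values A a =
     {y \<bullet> ones_vec (dim_col A) | y.
        y \<in> carrier_vec (dim_col A) \<and> 0\<^sub>v (dim_col A) \<le> y \<and>
        map_mat real A *\<^sub>v y = map_vec real_of_int a}"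

definition ip_values :: "nat mat \<Rightarrow> int vec \<Rightarrow> int set" where
  "ip_values A a =
     {int (y \<bullet> ones_vec (dim_col A)) | y :: nat vec.
        y \<in> carrier_vec (dim_col A) \<and> map_vec int (A *\<^sub>v y) = a}"

(* A minimum is finite iff it exists as an element of the set of values; over an empty feasible
   set it is infinite. The asserted equation of minima therefore includes that the minimum over
   the integral points exists. *)
definition integer_rounding_property :: "nat mat \<Rightarrow> bool" where
  "integer_rounding_property A \<longleftrightarrow>
     (\<forall>a \<in> carrier_vec (dim_row A). \<forall>m.
        is_minimum (lp_values A a) m \<longrightarrow> is_minimum (ip_values A a) \<lceil>m\<rceil>)"

(* Polynomials over 'k have type (nat =>0 nat) =>0 'k; the variables are indexed by nat, and x^v
   only involves the variables with index below dim_vec v. *)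
definition mvar :: "nat \<Rightarrow> (nat \<Rightarrow>\<^sub>0 nat) \<Rightarrow>\<^sub>0 'k::comm_ring_1" where
  "mvar i = Poly_Mapping.single (Poly_Mapping.single i 1) 1"

definition monomial_of :: "nat vec \<Rightarrow> (nat \<Rightarrow>\<^sub>0 nat) \<Rightarrow>\<^sub>0 'k::comm_ring_1" where
  "monomial_of v = (\<Prod>i<dim_vec v. mvar i ^ (v $ i))"

inductive_set subalgebra_generated ::
    "((nat \<Rightarrow>\<^sub>0 nat) \<Rightarrow>\<^sub>0 'k::comm_ring_1) set \<Rightarrow> ((nat \<Rightarrow>\<^sub>0 nat) \<Rightarrow>\<^sub>0 'k) set"
  for F where
    const: "Poly_Mapping.single 0 c \<in> subalgebra_generated F"
  | gen: "f \<in> F \<Longrightarrow> f \<in> subalgebra_generated F"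
  | add: "f \<in> subalgebra_generated F \<Longrightarrow> g \<in> subalgebra_generated F \<Longrightarrow>
      f + g \<in> subalgebra_generated F"
  | mult: "f \<in> subalgebra_generated F \<Longrightarrow> g \<in> subalgebra_generated F \<Longrightarrow>
      f * g \<in> subalgebra_generated F"

definition integral_over :: "'a::comm_ring_1 set \<Rightarrow> 'a \<Rightarrow> bool" where
  "integral_over R z \<longleftrightarrow>
     (\<exists>p. lead_coeff p = 1 \<and> (\<forall>i. coeff p i \<in> R) \<and> poly p z = 0)"

(* For a subring R of an integral domain, its field of fractions is realized inside
   the field of fractions of the ambient domain. *)
definition fraction_field_of :: "'a::idom set \<Rightarrow> 'a fract set" where
  "fraction_field_of R = {Fract a b | a b. a \<in> R \<and> b \<in> R \<and> b \<noteq> 0}"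

definition normal_subring :: "'a::idom set \<Rightarrow> bool" where
  "normal_subring R \<longleftrightarrow>
     (\<forall>z \<in> fraction_field_of R. integral_over (to_fract ` R) z \<longrightarrow> z \<in> to_fract ` R)"

definition torsion_free_group :: "('a, 'b) monoid_scheme \<Rightarrow> bool" where
  "torsion_free_group G \<longleftrightarrow> group G \<and>
     (\<forall>x \<in> carrier G. \<forall>k::nat. 0 < k \<and> x [^]\<^bsub>G\<^esub> k = \<one>\<^bsub>G\<^esub> \<longrightarrow> x = \<one>\<^bsub>G\<^esub>)"

definition column_lattice :: "nat mat \<Rightarrow> int vec set" where
  "column_lattice A =
     generate (monoid_vec TYPE(int) (dim_row A)) (map_vec int ` set (cols A))"

end

theory Submission
  imports Defs
begin

text \<open>
  Both directions reduce to one saturation property: every integral vector in the real cone of the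
  columns is a combination of the columns with natural coefficients.

  The rounding property implies saturation because a feasible linear program attains its
  minimum. Saturation gives torsion-freeness after adding a large multiple of all columns. It
  gives normality as follows: an element \<open>z = f / g\<close> integral over \<open>R = K[F]\<close> is almost integral,
  \<open>h z\<^sup>m \<in> R\<close> for all \<open>m\<close>; comparing lexicographically leading exponents, the leading exponent of \<open>z\<close>
  is in the closed cone, hence in the monoid, so the leading term of \<open>z\<close> can be split off, and the
  lexicographic order on exponents in finitely many variables is well-founded.

  Conversely, an integral \<open>a\<close> in the real cone has a positive multiple in the monoid, so \<open>a\<close> is in
  the lattice by torsion-freeness and the monomial of exponent \<open>a\<close> is in \<open>K[F]\<close> by normality. If all
  columns have the same entry sum, all feasible values of the linear program for \<open>a\<close> agree, so
  saturation gives the rounding property.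
\<close>

section \<open>Normality of monoid algebras\<close>

definition monoid_algebra :: "'a set \<Rightarrow> ('a \<Rightarrow>\<^sub>0 'k::zero) set" where
  "monoid_algebra S = {p. Poly_Mapping.keys p \<subseteq> S}"

locale add_submonoid =
  fixes S :: "'a::{ordered_cancel_comm_monoid_add, linorder} set"
  assumes zero_mem: "0 \<in> S" and add_mem: "\<And>s t. s \<in> S \<Longrightarrow> t \<in> S \<Longrightarrow> s + t \<in> S"
begin

lemma single_mem: "s \<in> S \<Longrightarrow> Poly_Mapping.single s c \<in> monoid_algebra S"
  by (auto simp: monoid_algebra_def)

lemma plus_mem:
  "p \<in> monoid_algebra S \<Longrightarrow> q \<in> monoid_algebra S \<Longrightarrow> p + q \<in> monoid_algebra S"
  using Poly_Mapping.keys_add[of p q] by (auto simp: monoid_algebra_def)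

lemma times_mem:
  "p \<in> monoid_algebra S \<Longrightarrow> q \<in> monoid_algebra S \<Longrightarrow> p * q \<in> monoid_algebra S"
  using keys_mult[of p q] by (fastforce simp: monoid_algebra_def intro: add_mem)

lemma uminus_mem:
  fixes p :: "'a \<Rightarrow>\<^sub>0 'k::ab_group_add"
  shows "p \<in> monoid_algebra S \<Longrightarrow> - p \<in> monoid_algebra S"
  by (auto simp: monoid_algebra_def in_keys_iff)

lemma const_mem: "Poly_Mapping.single 0 c \<in> monoid_algebra S"
  by (rule single_mem[OF zero_mem])

lemma one_mem: "1 \<in> monoid_algebra S"
  using zero_mem by (simp add: monoid_algebra_def)

lemma sum_mem: "(\<And>i. i \<in> I \<Longrightarrow> p i \<in> monoid_algebra S) \<Longrightarrow> (\<Sum>i\<in>I. p i) \<in> monoid_algebra S"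
proof (induction I rule: infinite_finite_induct)
qed (use const_mem[of 0] in \<open>auto intro: plus_mem\<close>)

lemma power_mem:
  fixes p :: "'a \<Rightarrow>\<^sub>0 'k::comm_semiring_1"
  shows "p \<in> monoid_algebra S \<Longrightarrow> p ^ m \<in> monoid_algebra S"
  by (induction m) (auto intro: times_mem one_mem)

end

section \<open>Leading exponents of products and powers\<close>

definition lead_exp :: "('a::linorder \<Rightarrow>\<^sub>0 'k::zero) \<Rightarrow> 'a" where
  "lead_exp p = Max (Poly_Mapping.keys p)"

lemma lead_exp_in_keys: "p \<noteq> 0 \<Longrightarrow> lead_exp p \<in> Poly_Mapping.keys p"
  unfolding lead_exp_def by (rule Max_in) (auto simp: poly_mapping_eq_iff fun_eq_iff in_keys_iff)

lemma lead_exp_max: "s \<in> Poly_Mapping.keys p \<Longrightarrow> s \<le> lead_exp p"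
  unfolding lead_exp_def by simp

text \<open>In a decomposition \<open>a + b = l + r\<close> with \<open>l \<le> a\<close> and
  \<open>r \<le> b\<close>, strict monotonicity of addition forces \<open>l = a\<close> and
  \<open>r = b\<close>, so the convolution has a single term. As \<open>a\<close> and
  \<open>b\<close> are only upper bounds, either coefficient may be zero.\<close>

lemma lookup_mult_bound:
  fixes p q :: "('a::{ordered_cancel_comm_monoid_add, linorder}) \<Rightarrow>\<^sub>0 'k::semiring_0"
  assumes "\<And>s. s \<in> Poly_Mapping.keys p \<Longrightarrow> s \<le> a" and "\<And>s. s \<in> Poly_Mapping.keys q \<Longrightarrow> s \<le> b"
  shows "Poly_Mapping.lookup (p * q) (a + b) = Poly_Mapping.lookup p a * Poly_Mapping.lookup q b"
proof -
  have "Poly_Mapping.lookup p l * (\<Sum>r. (Poly_Mapping.lookup q r when a + b = l + r))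
      = (Poly_Mapping.lookup p a * Poly_Mapping.lookup q b when l = a)" for l
  proof (cases "l = a")
    case True
    then show ?thesis by (simp add: eq_commute[of b])
  next
    case ne: False
    show ?thesis
    proof (cases "l \<in> Poly_Mapping.keys p")
      case True
      with ne assms(1) have "l < a" by fastforce
      have "(Poly_Mapping.lookup q r when a + b = l + r) = 0" for r
      proof (cases "a + b = l + r")
        case True
        have "\<not> r \<le> b"
        proof
          assume "r \<le> b"
          then have "l + r < a + b" using \<open>l < a\<close> by (rule add_less_le_mono[rotated])
          with True show False by simp
        qed
        then have "r \<notin> Poly_Mapping.keys q" using assms(2) by blast
        then show ?thesis by (simp add: in_keys_iff)
      qed simp
      then show ?thesis using ne by simp
    qed (use ne in \<open>simp add: in_keys_iff\<close>)
  qed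
  then show ?thesis by (simp add: lookup_mult)
qed

text \<open>The top coefficients have a nonzero product because there are no zero divisors; the
  other inequality holds since every key of the product is a sum of keys.\<close>

lemma lead_exp_mult:
  fixes p q :: "('a::{ordered_cancel_comm_monoid_add, linorder}) \<Rightarrow>\<^sub>0 'k::semiring_no_zero_divisors"
  assumes "p \<noteq> 0" "q \<noteq> 0"
  shows "lead_exp (p * q) = lead_exp p + lead_exp q"
proof (rule antisym)
  have "Poly_Mapping.lookup (p * q) (lead_exp p + lead_exp q) \<noteq> 0"
    using lead_exp_in_keys[OF assms(1)] lead_exp_in_keys[OF assms(2)]
    by (subst lookup_mult_bound) (auto simp: lead_exp_max in_keys_iff)
  then show "lead_exp p + lead_exp q \<le> lead_exp (p * q)"
    by (intro lead_exp_max) (simp add: in_keys_iff)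
  have "lead_exp (p * q) \<in> Poly_Mapping.keys (p * q)"
    using assms by (intro lead_exp_in_keys) simp
  then obtain s t where "lead_exp (p * q) = s + t" "s \<in> Poly_Mapping.keys p" "t \<in> Poly_Mapping.keys q"
    using keys_mult[of p q] by blast
  then show "lead_exp (p * q) \<le> lead_exp p + lead_exp q"
    by (simp add: add_mono lead_exp_max)
qed

text \<open>The iterated sum stands for the \<open>m\<close>-fold multiple, as a general ordered
  monoid has no scalar multiplication.\<close>

lemma lead_exp_power:
  fixes p :: "('a::{ordered_cancel_comm_monoid_add, linorder}) \<Rightarrow>\<^sub>0 'k::idom"
  assumes "p \<noteq> 0"
  shows "lead_exp (p ^ m) = (\<Sum>i<m. lead_exp p)"
  by (induction m) (use assms in \<open>simp_all add: lead_exp_mult add.commute, simp add: lead_exp_def\<close>)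

text \<open>Infinitely many variables would allow the infinite descent
  \<open>x_0 > x_1 > x_2 > ...\<close>. Exponents in the first \<open>n\<close> variables embed into
  lists of length \<open>n\<close> under \<open>lexn\<close>.\<close>

lemma wf_lex_exponents:
  "wf {(s, t :: nat \<Rightarrow>\<^sub>0 nat). Poly_Mapping.keys s \<subseteq> {..<n} \<and> Poly_Mapping.keys t \<subseteq> {..<n} \<and> s < t}"
proof (rule wf_subset[OF wf_inv_image[OF wf_lexn[OF wf_less_than, of n]]], rule subrelI)
  let ?f = "\<lambda>s :: nat \<Rightarrow>\<^sub>0 nat. map (Poly_Mapping.lookup s) [0..<n]"
  fix s t :: "nat \<Rightarrow>\<^sub>0 nat"
  assume "(s, t) \<in> {(s, t). Poly_Mapping.keys s \<subseteq> {..<n} \<and> Poly_Mapping.keys t \<subseteq> {..<n} \<and> s < t}"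
  then have st: "Poly_Mapping.keys s \<subseteq> {..<n}" "Poly_Mapping.keys t \<subseteq> {..<n}" "s < t" by auto
  from st(3) obtain k where k: "Poly_Mapping.lookup s k < Poly_Mapping.lookup t k"
      "\<And>i. i < k \<Longrightarrow> Poly_Mapping.lookup s i = Poly_Mapping.lookup t i"
    by (auto simp: less_poly_mapping.rep_eq less_fun_def)
  then have "k \<in> Poly_Mapping.keys t" by (auto simp: in_keys_iff)
  with st have "k < n" by auto
  then have split: "[0..<n] = [0..<k] @ k # [Suc k..<n]"
    using upt_add_eq_append[of 0 k "n - k"] upt_conv_Cons[of k n] by simp
  have pre: "map (Poly_Mapping.lookup s) [0..<k] = map (Poly_Mapping.lookup t) [0..<k]"
    using k(2) by simp
  have "(?f s, ?f t) \<in> lexn less_than n"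
    unfolding lexn_conv using k(1) pre
    by (auto intro!: exI[of _ "map (Poly_Mapping.lookup t) [0..<k]"] simp: split) (use \<open>k < n\<close> in auto)
  then show "(s, t) \<in> inv_image (lexn less_than n) ?f" by simp
qed

section \<open>Powers of integral elements\<close>

lemma to_fract_power: "to_fract (x ^ m) = to_fract x ^ m"
  by (induction m) simp_all

text \<open>\<open>g ^ degree p\<close> is a common denominator for all powers of the integral
  element \<open>f / g\<close>: up to exponent \<open>degree p\<close> it clears the denominator
  directly, and higher powers reduce to lower ones by the monic equation.\<close>

lemma (in add_submonoid) to_fract_power_mult_mem:
  fixes f g :: "'a \<Rightarrow>\<^sub>0 'k::field"
  assumes "f \<in> monoid_algebra S" "g \<in> monoid_algebra S" "g \<noteq> 0"
    and p: "lead_coeff p = 1" "\<And>i. coeff p i \<in> to_fract ` monoid_algebra S" "poly p (Fract f g) = 0"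
  shows "to_fract (g ^ degree p) * Fract f g ^ m \<in> to_fract ` monoid_algebra S"
proof (induction m rule: less_induct)
  case (less m)
  let ?R = "monoid_algebra S :: ('a \<Rightarrow>\<^sub>0 'k) set" and ?z = "Fract f g"
  let ?d = "degree p" and ?G = "to_fract (g ^ degree p)"
  have zg: "?z * to_fract g = to_fract f"
    using assms(3) by (simp add: to_fract_def eq_fract mult.commute)
  show ?case
  proof (cases "m \<le> ?d")
    case True
    have "?G * ?z ^ m = to_fract (g ^ (?d - m)) * (?z * to_fract g) ^ m"
      using True by (simp add: to_fract_power power_mult_distrib mult_ac flip: power_add)
    also have "\<dots> = to_fract (g ^ (?d - m) * f ^ m)"
      by (simp add: zg to_fract_power)
    finally show ?thesis
      using assms(1,2) by (metis imageI times_mem power_mem)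
  next
    case False
    have "0 = (\<Sum>i\<le>?d. coeff p i * ?z ^ i)"
      using p(3) by (simp add: poly_altdef)
    also have "\<dots> = (\<Sum>i<?d. coeff p i * ?z ^ i) + ?z ^ ?d"
      using p(1) by (simp flip: lessThan_Suc_atMost)
    finally have "?z ^ ?d = - (\<Sum>i<?d. coeff p i * ?z ^ i)"
      by (simp add: eq_neg_iff_add_eq_0 add.commute)
    moreover have "?z ^ m = ?z ^ (m - ?d) * ?z ^ ?d"
      using False by (simp flip: power_add)
    \<comment> \<open>The monic equation times \<open>?z ^ (m - ?d)\<close>: every exponent on the
      right is \<open>m - ?d + i < m\<close>, so the induction hypothesis will apply.\<close>
    ultimately have eq: "?G * ?z ^ m = - (\<Sum>i<?d. coeff p i * (?G * ?z ^ (m - ?d + i)))"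
      by (simp add: sum_distrib_left power_add mult_ac)
    have "\<exists>r \<in> ?R. coeff p i * (?G * ?z ^ (m - ?d + i)) = to_fract r" if "i < ?d" for i
    proof -
      have "?G * ?z ^ (m - ?d + i) \<in> to_fract ` ?R"
        using that False by (intro less) auto
      with p(2)[of i] obtain r s where "r \<in> ?R" "s \<in> ?R" "coeff p i = to_fract r"
        "?G * ?z ^ (m - ?d + i) = to_fract s" by auto
      then show ?thesis by (intro bexI[of _ "r * s"]) (auto intro: times_mem)
    qed
    then obtain r where r: "\<And>i. i < ?d \<Longrightarrow> r i \<in> ?R"
        "\<And>i. i < ?d \<Longrightarrow> coeff p i * (?G * ?z ^ (m - ?d + i)) = to_fract (r i)" by metis
    have "?G * ?z ^ m = to_fract (- (\<Sum>i<?d. r i))"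
      unfolding eq using r(2) by simp
    moreover have "- (\<Sum>i<?d. r i) \<in> ?R"
      using r(1) by (intro uminus_mem sum_mem) simp
    ultimately show ?thesis by blast
  qed
qed

text \<open>The assumption \<open>closed\<close> says that an exponent difference \<open>t = u - v\<close> with \<open>b + m t \<in> S\<close> for
  all \<open>m\<close> lies in \<open>S\<close>; writing \<open>t\<close> as a difference keeps all exponents natural.\<close>
locale closed_exponent_monoid = add_submonoid S for S :: "(nat \<Rightarrow>\<^sub>0 nat) set" +
  fixes n :: nat
  assumes vars: "\<And>s. s \<in> S \<Longrightarrow> Poly_Mapping.keys s \<subseteq> {..<n}"
    and closed: "\<And>b u v. b \<in> S \<Longrightarrow> u \<in> S \<Longrightarrow> v \<in> S \<Longrightarrow>
      (\<And>m::nat. \<exists>w\<in>S. b + (\<Sum>i<m. u) = (\<Sum>i<m. v) + w) \<Longrightarrow> \<exists>s\<in>S. u = v + s"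
begin

text \<open>Taking leading exponents in \<open>h f\<^sup>m = g\<^sup>m r\<close> shows that the leading exponent of \<open>f / g\<close> lies in
  \<open>S\<close>; subtracting that leading term from \<open>f / g\<close> preserves the hypothesis.\<close>
lemma divides_if_almost_integral:
  fixes f g h :: "(nat \<Rightarrow>\<^sub>0 nat) \<Rightarrow>\<^sub>0 'k::field"
  assumes g: "g \<in> monoid_algebra S" "g \<noteq> 0" and h: "h \<in> monoid_algebra S" "h \<noteq> 0"
    and "f \<in> monoid_algebra S" "\<And>m. \<exists>r\<in>monoid_algebra S. h * f ^ m = g ^ m * r"
  shows "\<exists>r\<in>monoid_algebra S. f = g * r"
  using assms(5,6)
proof (induction "lead_exp f" arbitrary: f rule: wf_induct_rule[OF wf_lex_exponents[of n]])
  case (1 f)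
  let ?R = "monoid_algebra S :: ((nat \<Rightarrow>\<^sub>0 nat) \<Rightarrow>\<^sub>0 'k) set"
  have lead_mem: "lead_exp p \<in> S" if "p \<in> ?R" "p \<noteq> 0" for p :: "(nat \<Rightarrow>\<^sub>0 nat) \<Rightarrow>\<^sub>0 'k"
    using lead_exp_in_keys[OF that(2)] that(1) by (auto simp: monoid_algebra_def)
  show ?case
  \<comment> \<open>\<open>lead_exp 0\<close> is unspecified, so zero is treated apart, here and for
    the remainder \<open>f'\<close>.\<close>
  proof (cases "f = 0")
    case True
    then show ?thesis using const_mem[of 0] by (intro bexI[of _ 0]) auto
  next
    case f: False
    obtain r where r: "\<And>m. r m \<in> ?R" "\<And>m. h * f ^ m = g ^ m * r m"
      using "1.prems"(2) by metis
    have "\<exists>w\<in>S. lead_exp h + (\<Sum>i<m. lead_exp f) = (\<Sum>i<m. lead_exp g) + w" for m :: nat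
    proof -
      have "h * f ^ m \<noteq> 0" using f h by simp
      with r(2)[of m] have "r m \<noteq> 0" by auto
      then have "lead_exp (r m) \<in> S" using r(1) by (intro lead_mem)
      moreover have "lead_exp h + (\<Sum>i<m. lead_exp f) = (\<Sum>i<m. lead_exp g) + lead_exp (r m)"
        using arg_cong[OF r(2)[of m], of lead_exp] f g h \<open>r m \<noteq> 0\<close>
        by (simp add: lead_exp_mult lead_exp_power del: sum_constant)
      ultimately show ?thesis by blast
    qed
    then obtain s where s: "s \<in> S" "lead_exp f = lead_exp g + s"
      using closed lead_mem f g h "1.prems"(1) by meson
    \<comment> \<open>Chosen so that \<open>g * t\<close> and \<open>f\<close> have the same leading
      term.\<close>
    define c where "c = Poly_Mapping.lookup f (lead_exp f) / Poly_Mapping.lookup g (lead_exp g)"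
    define t where "t = Poly_Mapping.single s c"
    define f' where "f' = f - g * t"
    have t: "t \<in> ?R" unfolding t_def by (rule single_mem[OF s(1)])
    have minus_mem: "p - q \<in> ?R" if "p \<in> ?R" "q \<in> ?R" for p q :: "(nat \<Rightarrow>\<^sub>0 nat) \<Rightarrow>\<^sub>0 'k"
      using plus_mem[OF that(1) uminus_mem[OF that(2)]] by simp
    have f'R: "f' \<in> ?R"
      unfolding f'_def using "1.prems"(1) g t by (intro minus_mem times_mem)
    \<comment> \<open>Binomial expansion: \<open>h * f ^ i\<close> supplies the factor
      \<open>g ^ i\<close> and \<open>(g * t) ^ (m - i)\<close> the rest of \<open>g ^ m\<close>, so
      the hypothesis passes to \<open>f'\<close> with the same \<open>h\<close>.\<close>
    have powers: "\<exists>r\<in>?R. h * f' ^ m = g ^ m * r" for m :: nat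
    proof -
      have "h * f' ^ m = (\<Sum>i\<le>m. of_nat (m choose i) * (h * f ^ i) * (- (g * t)) ^ (m - i))"
        unfolding f'_def diff_conv_add_uminus[of f] binomial_ring
        by (simp add: sum_distrib_left mult_ac)
      also have "\<dots> = (\<Sum>i\<le>m. g ^ m * (of_nat (m choose i) * r i * (- t) ^ (m - i)))"
      proof (rule sum.cong)
        fix i assume "i \<in> {..m}"
        then have "g ^ m = g ^ i * g ^ (m - i)" by (simp flip: power_add)
        moreover have "(- (g * t)) ^ (m - i) = g ^ (m - i) * (- t) ^ (m - i)"
          by (simp flip: power_mult_distrib)
        ultimately show "of_nat (m choose i) * (h * f ^ i) * (- (g * t)) ^ (m - i)
            = g ^ m * (of_nat (m choose i) * r i * (- t) ^ (m - i))"
          by (simp add: r(2) mult_ac)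
      qed simp
      finally have "h * f' ^ m = g ^ m * (\<Sum>i\<le>m. of_nat (m choose i) * r i * (- t) ^ (m - i))"
        by (simp add: sum_distrib_left)
      moreover have "(of_nat k :: (nat \<Rightarrow>\<^sub>0 nat) \<Rightarrow>\<^sub>0 'k) \<in> ?R" for k
        using const_mem[of "of_nat k"] by simp
      then have "(\<Sum>i\<le>m. of_nat (m choose i) * r i * (- t) ^ (m - i)) \<in> ?R"
        using r(1) t by (intro sum_mem times_mem power_mem uminus_mem)
      ultimately show ?thesis by blast
    qed
    have "\<exists>r\<in>?R. f' = g * r"
    proof (cases "f' = 0")
      case True
      then show ?thesis using const_mem[of 0] by (intro bexI[of _ 0]) auto
    next
      case f': False
      \<comment> \<open>Neither \<open>f\<close> nor \<open>g * t\<close> has an exponent above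
        \<open>lead_exp f\<close>, and their coefficients there cancel, so the leading exponent of
        \<open>f'\<close> is strictly smaller.\<close>
      have bound: "k \<le> lead_exp f" if "k \<in> Poly_Mapping.keys f'" for k
      proof -
        have "k \<in> Poly_Mapping.keys f \<or> k \<in> Poly_Mapping.keys (g * t)"
          using that keys_diff by (auto simp: f'_def in_keys_iff lookup_minus)
        moreover have "k \<le> lead_exp f" if "k \<in> Poly_Mapping.keys (g * t)"
        proof -
          from that keys_mult[of g t] obtain l where "l \<in> Poly_Mapping.keys g" "k = l + s"
            by (auto simp: t_def split: if_splits)
          then show ?thesis using s(2) by (simp add: lead_exp_max add_right_mono)
        qed
        ultimately show ?thesis using lead_exp_max by blast
      qed
      have "Poly_Mapping.lookup (g * t) (lead_exp f) = Poly_Mapping.lookup g (lead_exp g) * c"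
        unfolding s(2) by (subst lookup_mult_bound) (auto simp: t_def lead_exp_max split: if_splits)
      also have "\<dots> = Poly_Mapping.lookup f (lead_exp f)"
        using lead_exp_in_keys[OF g(2)] by (simp add: c_def in_keys_iff)
      finally have "lead_exp f \<notin> Poly_Mapping.keys f'"
        by (simp add: f'_def in_keys_iff lookup_minus)
      then have "lead_exp f' < lead_exp f"
        using bound[OF lead_exp_in_keys[OF f']] lead_exp_in_keys[OF f'] by (metis order_le_less)
      then show ?thesis
        using vars[OF lead_mem[OF f'R f']] vars[OF lead_mem[OF "1.prems"(1) f]]
        by (intro "1.hyps" f'R powers) auto
    qed
    then obtain r' where "r' \<in> ?R" "f' = g * r'" by blast
    then have "f = g * (r' + t)" "r' + t \<in> ?R"
      using t by (auto simp: f'_def algebra_simps intro: plus_mem)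
    then show ?thesis by blast
  qed
qed

text \<open>An integral \<open>z = f / g\<close> is almost integral with multiplier
  \<open>h = g ^ degree p\<close>. Clearing denominators in \<open>h * z ^ m\<close> gives the
  divisibility hypothesis, and the resulting \<open>f = g * r\<close> says
  \<open>z = r\<close>.\<close>

lemma normal_monoid_algebra:
  "normal_subring (monoid_algebra S :: ((nat \<Rightarrow>\<^sub>0 nat) \<Rightarrow>\<^sub>0 'k::field) set)"
  unfolding normal_subring_def
proof (intro ballI impI)
  let ?R = "monoid_algebra S :: ((nat \<Rightarrow>\<^sub>0 nat) \<Rightarrow>\<^sub>0 'k) set"
  fix z assume "z \<in> fraction_field_of ?R" "integral_over (to_fract ` ?R) z"
  then obtain f g p where fg: "z = Fract f g" "f \<in> ?R" "g \<in> ?R" "g \<noteq> 0"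
    and p: "lead_coeff p = 1" "\<And>i. coeff p i \<in> to_fract ` ?R" "poly p z = 0"
    unfolding fraction_field_of_def integral_over_def by blast
  have zg: "z * to_fract g = to_fract f"
    using fg by (simp add: to_fract_def eq_fract mult.commute)
  let ?h = "g ^ degree p"
  have "\<exists>r\<in>?R. ?h * f ^ m = g ^ m * r" for m :: nat
  proof -
    from to_fract_power_mult_mem[OF fg(2-4) p(1,2), of m] p(3) fg(1)
    obtain r where r: "r \<in> ?R" "to_fract ?h * z ^ m = to_fract r" by auto
    have "to_fract (?h * f ^ m) = to_fract ?h * z ^ m * to_fract (g ^ m)"
      by (simp add: to_fract_power power_mult_distrib mult_ac flip: zg)
    also have "\<dots> = to_fract (g ^ m * r)" using r(2) by (simp add: mult.commute)
    finally have "?h * f ^ m = g ^ m * r" by (simp only: to_fract_eq_iff)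
    then show ?thesis using r(1) by blast
  qed
  then obtain r where "r \<in> ?R" "f = g * r"
    using divides_if_almost_integral[of g ?h f] fg by (auto intro: power_mem)
  then show "z \<in> to_fract ` ?R"
    using fg by (auto simp: to_fract_def eq_fract mult.commute intro!: image_eqI[of _ _ r])
qed

end

section \<open>Real and integral points of the column cone\<close>

text \<open>Bolzano-Weierstrass by induction on the number of coordinates: each new coordinate
  refines the previous subsequence to a monotone one, which converges because it is bounded.\<close>

lemma convergent_subsequence_coordinates:
  fixes Y :: "nat \<Rightarrow> nat \<Rightarrow> real"
  assumes "\<And>m j. j < q \<Longrightarrow> \<bar>Y m j\<bar> \<le> B"
  shows "\<exists>r l. strict_mono (r :: nat \<Rightarrow> nat) \<and> (\<forall>j<q. (\<lambda>m. Y (r m) j) \<longlonglongrightarrow> l j)"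
  using assms
proof (induction q)
  case 0
  show ?case by (auto intro!: exI[of _ id] simp: strict_mono_def)
next
  case (Suc q)
  then obtain r l where r: "strict_mono (r :: nat \<Rightarrow> nat)" "\<And>j. j < q \<Longrightarrow> (\<lambda>m. Y (r m) j) \<longlonglongrightarrow> l j"
    by (metis less_Suc_eq)
  obtain f where f: "strict_mono (f :: nat \<Rightarrow> nat)" "monoseq (\<lambda>m. Y (r (f m)) q)"
    using seq_monosub[of "\<lambda>m. Y (r m) q"] by blast
  have "Bseq (\<lambda>m. Y (r (f m)) q)"
    using Suc.prems[of q] by (intro BseqI'[of _ B]) simp
  then obtain c where c: "(\<lambda>m. Y (r (f m)) q) \<longlonglongrightarrow> c"
    using Bseq_monoseq_convergent[OF _ f(2)] by (auto simp: convergent_def)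
  have "(\<lambda>m. Y ((r \<circ> f) m) j) \<longlonglongrightarrow> (l(q := c)) j" if "j < Suc q" for j
    using that c LIMSEQ_subseq_LIMSEQ[OF r(2) f(1), of j]
    by (cases "j = q") (auto simp: o_def less_Suc_eq)
  then show ?case
    using strict_mono_o[OF r(1) f(1)] by blast
qed

text \<open>The matrix is nonnegative without zero columns, so each coefficient is dominated by a
  convergent row sum. Hence a subsequence converges, and its limit solves the system. The
  subsequence is returned too, because minimization needs the limit of the objective along
  it.\<close>

lemma cone_closed:
  fixes Y :: "nat \<Rightarrow> nat \<Rightarrow> real" and M :: "nat \<Rightarrow> nat \<Rightarrow> nat" and a :: "nat \<Rightarrow> real"
  assumes nonneg: "\<And>m j. j < q \<Longrightarrow> 0 \<le> Y m j"
    and lim: "\<And>i. i < n \<Longrightarrow> (\<lambda>m. \<Sum>j<q. real (M i j) * Y m j) \<longlonglongrightarrow> a i"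
    and col: "\<And>j. j < q \<Longrightarrow> \<exists>i<n. M i j \<noteq> 0"
  shows "\<exists>r l. strict_mono (r :: nat \<Rightarrow> nat) \<and> (\<forall>j<q. (\<lambda>m. Y (r m) j) \<longlonglongrightarrow> l j) \<and>
    (\<forall>j<q. 0 \<le> l j) \<and> (\<forall>i<n. (\<Sum>j<q. real (M i j) * l j) = a i)"
proof -
  have "\<exists>B. \<forall>m. \<bar>\<Sum>j<q. real (M i j) * Y m j\<bar> \<le> B" if "i < n" for i
    using Bseq_conv_Bfun convergent_imp_Bseq[OF convergentI[OF lim[OF that]]]
    by (auto simp: Bseq_def)
  then obtain B where B: "\<And>i m. i < n \<Longrightarrow> \<bar>\<Sum>j<q. real (M i j) * Y m j\<bar> \<le> B i" by metis
  \<comment> \<open>The dominating row depends on \<open>j\<close>; summing over all rows gives one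
    bound for every coordinate.\<close>
  have bound: "\<bar>Y m j\<bar> \<le> (\<Sum>i<n. \<bar>B i\<bar>)" if j: "j < q" for m j
  proof -
    from col[OF j] obtain i where i: "i < n" "M i j \<noteq> 0" by blast
    have "1 * Y m j \<le> real (M i j) * Y m j"
      using i nonneg[OF j] by (intro mult_right_mono) auto
    also have "\<dots> \<le> (\<Sum>j<q. real (M i j) * Y m j)"
      using j nonneg by (intro member_le_sum) auto
    also have "\<dots> \<le> \<bar>B i\<bar>" using B[OF i(1), of m] by linarith
    also have "\<dots> \<le> (\<Sum>i<n. \<bar>B i\<bar>)" using i by (intro member_le_sum) auto
    finally show ?thesis using nonneg[OF j, of m] by simp
  qed
  obtain r l where r: "strict_mono (r :: nat \<Rightarrow> nat)" "\<And>j. j < q \<Longrightarrow> (\<lambda>m. Y (r m) j) \<longlonglongrightarrow> l j"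
    using convergent_subsequence_coordinates[of q Y, OF bound] by blast
  have "0 \<le> l j" if "j < q" for j
    using r(2)[OF that] nonneg[OF that] by (intro LIMSEQ_le_const) auto
  moreover have "(\<Sum>j<q. real (M i j) * l j) = a i" if "i < n" for i
  proof (rule LIMSEQ_unique)
    show "(\<lambda>m. \<Sum>j<q. real (M i j) * Y (r m) j) \<longlonglongrightarrow> (\<Sum>j<q. real (M i j) * l j)"
      using r(2) by (intro tendsto_sum tendsto_mult_left) auto
    show "(\<lambda>m. \<Sum>j<q. real (M i j) * Y (r m) j) \<longlonglongrightarrow> a i"
      using LIMSEQ_subseq_LIMSEQ[OF lim[OF that] r(1)] by (simp add: o_def)
  qed
  ultimately show ?thesis using r by blast
qed

text \<open>The integral remainders of \<open>a m\<close> after rounding down \<open>m y\<close> are bounded, so two of them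
  coincide; subtracting gives a multiple of \<open>a\<close>.\<close>
lemma multiple_in_column_monoid:
  fixes y :: "nat \<Rightarrow> real" and M :: "nat \<Rightarrow> nat \<Rightarrow> nat" and a :: "nat \<Rightarrow> int"
  assumes nonneg: "\<And>j. j < q \<Longrightarrow> 0 \<le> y j"
    and sol: "\<And>i. i < n \<Longrightarrow> (\<Sum>j<q. real (M i j) * y j) = real_of_int (a i)"
  obtains k w where "0 < k" "\<And>i. i < n \<Longrightarrow> (\<Sum>j<q. int (M i j) * int (w j)) = int k * a i"
proof -
  define w where "w m j = nat \<lfloor>real m * y j\<rfloor>" for m j
  define \<rho> where "\<rho> m i = int m * a i - (\<Sum>j<q. int (M i j) * int (w m j))" for m i
  define B where "B = (\<Sum>i<n. \<Sum>j<q. int (M i j))"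
  \<comment> \<open>The remainder weights row \<open>i\<close> by fractional parts between 0 and 1,
    so it lies between 0 and the row sum; \<open>B\<close> bounds all row sums at once.\<close>
  have \<rho>: "\<rho> m i \<in> {0..B}" if i: "i < n" for m i
  proof -
    have w: "real (w m j) \<le> real m * y j" "real m * y j \<le> real (w m j) + 1" if "j < q" for j
      using nonneg[OF that] by (auto simp: w_def)
    have eq: "real_of_int (\<rho> m i) = (\<Sum>j<q. real (M i j) * (real m * y j - real (w m j)))"
      by (simp add: \<rho>_def right_diff_distrib sum_subtractf mult.left_commute[of _ "real m"]
          flip: sol[OF i] sum_distrib_left)
    have "0 \<le> real_of_int (\<rho> m i)" unfolding eq using w by (intro sum_nonneg) auto
    moreover have "real_of_int (\<rho> m i) \<le> real_of_int (\<Sum>j<q. int (M i j))"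
    proof -
      have "(\<Sum>j<q. real (M i j) * (real m * y j - real (w m j))) \<le> (\<Sum>j<q. real (M i j) * 1)"
      using w(2) by (intro sum_mono mult_left_mono) (auto simp: algebra_simps)
      then show ?thesis unfolding eq by simp
    qed
    moreover have "(\<Sum>j<q. int (M i j)) \<le> B"
      unfolding B_def using i by (intro member_le_sum) (auto intro: sum_nonneg)
    ultimately show ?thesis by (simp only: of_int_0_le_iff of_int_le_iff atLeastAtMost_iff) (auto intro: order_trans)
  qed
  have "finite ((\<lambda>m. map (\<rho> m) [0..<n]) ` UNIV)"
    by (rule finite_subset[OF _ finite_lists_length_eq[of "{0..B}" n]]) (use \<rho> in auto)
  then have "\<not> inj (\<lambda>m. map (\<rho> m) [0..<n])"
    using finite_imageD infinite_UNIV_nat by blast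
  then obtain m m' where mm: "m < m'" "map (\<rho> m) [0..<n] = map (\<rho> m') [0..<n]"
    unfolding inj_def by (metis linorder_neqE_nat)
  \<comment> \<open>Rounding down is monotone in \<open>m\<close>, so the natural subtraction in the
    witness below is not truncated.\<close>
  have le: "w m j \<le> w m' j" if "j < q" for j
    unfolding w_def using mm(1) nonneg[OF that]
    by (intro nat_mono floor_mono mult_right_mono) auto
  show ?thesis
  proof (rule that[of "m' - m" "\<lambda>j. w m' j - w m j"])
    fix i assume i: "i < n"
    then have "\<rho> m i = \<rho> m' i" using mm(2) by auto
    then have "int (m' - m) * a i = (\<Sum>j<q. int (M i j) * int (w m' j)) - (\<Sum>j<q. int (M i j) * int (w m j))"
      using mm(1) by (simp add: \<rho>_def of_nat_diff algebra_simps)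
    also have "\<dots> = (\<Sum>j<q. int (M i j) * int (w m' j - w m j))"
      unfolding sum_subtractf[symmetric] using le by (intro sum.cong) (auto simp: of_nat_diff algebra_simps)
    finally show "(\<Sum>j<q. int (M i j) * int (w m' j - w m j)) = int (m' - m) * a i" ..
  qed (use mm in simp)
qed

section \<open>Feasible values of the linear and the integer program\<close>

lemma lp_values_iff:
  assumes "a \<in> carrier_vec (dim_row A)"
  shows "x \<in> lp_values A a \<longleftrightarrow> (\<exists>y :: nat \<Rightarrow> real. (\<forall>j<dim_col A. 0 \<le> y j) \<and>
    (\<forall>i<dim_row A. (\<Sum>j<dim_col A. real (A $$ (i, j)) * y j) = real_of_int (a $ i)) \<and>
    x = (\<Sum>j<dim_col A. y j))" (is "_ \<longleftrightarrow> ?R")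
proof
  assume "x \<in> lp_values A a"
  then obtain y where y: "y \<in> carrier_vec (dim_col A)" "0\<^sub>v (dim_col A) \<le> y"
      "map_mat real A *\<^sub>v y = map_vec real_of_int a" "x = y \<bullet> ones_vec (dim_col A)"
    unfolding lp_values_def by blast
  have "(\<Sum>j<dim_col A. real (A $$ (i, j)) * y $ j) = real_of_int (a $ i)" if "i < dim_row A" for i
    using arg_cong[OF y(3), of "\<lambda>v. v $ i"] that y(1) assms
    by (simp add: scalar_prod_def lessThan_atLeast0)
  then show ?R using y
    by (intro exI[of _ "\<lambda>j. y $ j"])
       (auto simp: less_eq_vec_def scalar_prod_def ones_vec_def lessThan_atLeast0)
next
  assume ?R
  then obtain y :: "nat \<Rightarrow> real" where y: "\<forall>j<dim_col A. 0 \<le> y j"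
    "\<forall>i<dim_row A. (\<Sum>j<dim_col A. real (A $$ (i, j)) * y j) = real_of_int (a $ i)"
    "x = (\<Sum>j<dim_col A. y j)" by blast
  have "map_mat real A *\<^sub>v vec (dim_col A) y = map_vec real_of_int a"
    using y(2) assms by (intro eq_vecI) (auto simp: scalar_prod_def lessThan_atLeast0)
  then show "x \<in> lp_values A a"
    unfolding lp_values_def using y(1,3)
    by (auto simp: less_eq_vec_def scalar_prod_def ones_vec_def lessThan_atLeast0 intro!: exI[of _ "vec (dim_col A) y"])
qed

lemma ip_values_iff:
  assumes "a \<in> carrier_vec (dim_row A)"
  shows "x \<in> ip_values A a \<longleftrightarrow> (\<exists>y :: nat \<Rightarrow> nat.
    (\<forall>i<dim_row A. (\<Sum>j<dim_col A. int (A $$ (i, j)) * int (y j)) = a $ i) \<and>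
    x = (\<Sum>j<dim_col A. int (y j)))" (is "_ \<longleftrightarrow> ?R")
proof
  assume "x \<in> ip_values A a"
  then obtain y where y: "y \<in> carrier_vec (dim_col A)"
      "map_vec int (A *\<^sub>v y) = a" "x = int (y \<bullet> ones_vec (dim_col A))"
    unfolding ip_values_def by blast
  have "(\<Sum>j<dim_col A. int (A $$ (i, j)) * int (y $ j)) = a $ i" if "i < dim_row A" for i
    using arg_cong[OF y(2), of "\<lambda>v. v $ i"] that y(1)
    by (simp add: scalar_prod_def lessThan_atLeast0)
  then show ?R using y
    by (intro exI[of _ "\<lambda>j. y $ j"])
       (auto simp: scalar_prod_def ones_vec_def lessThan_atLeast0)
next
  assume ?R
  then obtain y :: "nat \<Rightarrow> nat" where y:
    "\<forall>i<dim_row A. (\<Sum>j<dim_col A. int (A $$ (i, j)) * int (y j)) = a $ i"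
    "x = (\<Sum>j<dim_col A. int (y j))" by blast
  have "map_vec int (A *\<^sub>v vec (dim_col A) y) = a"
    using y(1) assms by (intro eq_vecI) (auto simp: scalar_prod_def lessThan_atLeast0)
  then show "x \<in> ip_values A a"
    unfolding ip_values_def using y(2)
    by (auto simp: scalar_prod_def ones_vec_def lessThan_atLeast0 intro!: exI[of _ "vec (dim_col A) y"])
qed

lemma lp_value_if_ip_value:
  assumes "a \<in> carrier_vec (dim_row A)" "x \<in> ip_values A a"
  shows "real_of_int x \<in> lp_values A a"
proof -
  from assms obtain y :: "nat \<Rightarrow> nat" where
    y: "\<forall>i<dim_row A. (\<Sum>j<dim_col A. int (A $$ (i, j)) * int (y j)) = a $ i"
    "x = (\<Sum>j<dim_col A. int (y j))" by (auto simp: ip_values_iff)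
  have "(\<Sum>j<dim_col A. real (A $$ (i, j)) * real (y j)) = real_of_int (a $ i)" if "i < dim_row A" for i
    using arg_cong[OF y(1)[rule_format, OF that], of real_of_int] by simp
  then show ?thesis
    using assms(1) y(2) by (auto simp: lp_values_iff intro!: exI[of _ "\<lambda>j. real (y j)"])
qed

text \<open>The objective is bounded below by 0. A minimizing sequence of feasible points has a
  constant right-hand side, so \<open>cone_closed\<close> yields a feasible limit, and its objective
  value is the infimum.\<close>

lemma lp_minimum_exists:
  assumes a: "a \<in> carrier_vec (dim_row A)" and "lp_values A a \<noteq> {}"
    and col: "\<And>j. j < dim_col A \<Longrightarrow> \<exists>i<dim_row A. A $$ (i, j) \<noteq> 0"
  shows "\<exists>m. is_minimum (lp_values A a) m"
proof -
  let ?I = "Inf (lp_values A a)"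
  have bdd: "bdd_below (lp_values A a)"
    using a by (intro bdd_belowI[of _ 0]) (auto simp: lp_values_iff intro!: sum_nonneg)
  have "\<exists>x\<in>lp_values A a. x < ?I + inverse (real (Suc m))" for m
    using cInf_less_iff[OF assms(2) bdd, of "?I + inverse (real (Suc m))"] by simp
  then obtain x where x: "\<And>m. x m \<in> lp_values A a" "\<And>m. x m < ?I + inverse (real (Suc m))"
    by metis
  have "x \<longlonglongrightarrow> ?I"
  proof (rule tendsto_sandwich)
    show "\<forall>\<^sub>F m in sequentially. ?I \<le> x m" using x(1) bdd by (simp add: cInf_lower)
    show "\<forall>\<^sub>F m in sequentially. x m \<le> ?I + inverse (real (Suc m))" using x(2) by (simp add: less_imp_le)
    show "(\<lambda>m. ?I + inverse (real (Suc m))) \<longlonglongrightarrow> ?I"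
      by (rule LIMSEQ_inverse_real_of_nat_add)
  qed simp
  from x(1) a obtain Y :: "nat \<Rightarrow> nat \<Rightarrow> real" where
    Y: "\<And>m j. j < dim_col A \<Longrightarrow> 0 \<le> Y m j"
      "\<And>m i. i < dim_row A \<Longrightarrow> (\<Sum>j<dim_col A. real (A $$ (i, j)) * Y m j) = real_of_int (a $ i)"
      "\<And>m. x m = (\<Sum>j<dim_col A. Y m j)"
    unfolding lp_values_iff[OF a] by metis
  obtain r l where r: "strict_mono (r :: nat \<Rightarrow> nat)" "\<And>j. j < dim_col A \<Longrightarrow> (\<lambda>m. Y (r m) j) \<longlonglongrightarrow> l j"
    "\<And>j. j < dim_col A \<Longrightarrow> 0 \<le> l j"
    "\<And>i. i < dim_row A \<Longrightarrow> (\<Sum>j<dim_col A. real (A $$ (i, j)) * l j) = real_of_int (a $ i)"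
    using cone_closed[of "dim_col A" Y "dim_row A" "\<lambda>i j. A $$ (i, j)" "\<lambda>i. real_of_int (a $ i)",
        OF Y(1) _ col] by (simp add: Y(2)) blast
  have "(\<Sum>j<dim_col A. l j) = ?I"
  proof (rule LIMSEQ_unique)
    show "(\<lambda>m. x (r m)) \<longlonglongrightarrow> (\<Sum>j<dim_col A. l j)"
      unfolding Y(3) using r(2) by (intro tendsto_sum) auto
    show "(\<lambda>m. x (r m)) \<longlonglongrightarrow> ?I"
      using LIMSEQ_subseq_LIMSEQ[OF \<open>x \<longlonglongrightarrow> ?I\<close> r(1)] by (simp add: o_def)
  qed
  then have "?I \<in> lp_values A a"
    unfolding lp_values_iff[OF a] using r(3,4) by metis
  then show ?thesis
    using bdd by (auto simp: is_minimum_def intro: cInf_lower)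
qed

text \<open>Saturation from rounding: feasibility already yields a minimum of the linear program,
  and the integral minimum that the rounding property then provides is a member of
  \<open>ip_values A a\<close>.\<close>

lemma ip_feasible_if_rounding:
  assumes "integer_rounding_property A" "a \<in> carrier_vec (dim_row A)" "lp_values A a \<noteq> {}"
    and "\<And>j. j < dim_col A \<Longrightarrow> \<exists>i<dim_row A. A $$ (i, j) \<noteq> 0"
  shows "ip_values A a \<noteq> {}"
  using lp_minimum_exists[OF assms(2-4)] assms(1,2)
  unfolding integer_rounding_property_def is_minimum_def by blast

section \<open>The column lattice and the column monoid\<close>

text \<open>Left to right is induction on \<open>generate\<close>; conversely, the combination is
  built up inside the subgroup one column at a time.\<close>

lemma column_lattice_iff:
  "b \<in> column_lattice A \<longleftrightarrow> b \<in> carrier_vec (dim_row A) \<and>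
    (\<exists>c :: nat \<Rightarrow> int. \<forall>i<dim_row A. b $ i = (\<Sum>j<dim_col A. int (A $$ (i, j)) * c j))"
  (is "_ \<longleftrightarrow> ?R b")
proof
  let ?n = "dim_row A" and ?q = "dim_col A"
  let ?G = "monoid_vec TYPE(int) ?n"
  let ?H = "map_vec int ` set (cols A)"
  interpret G: comm_group ?G by (rule comm_group_vec)
  have inv: "inv\<^bsub>?G\<^esub> v = - v" if "v \<in> carrier_vec ?n" for v
    using that by (intro G.inv_equality) (auto simp: monoid_vec_simps)
  have gens: "?H \<subseteq> carrier_vec ?n" by (auto simp: cols_def)
  {
    assume "b \<in> column_lattice A"
    then have "b \<in> generate ?G ?H" by (simp add: column_lattice_def)
    then show "?R b"
    proof induction
      case one
      show ?case by (auto simp: monoid_vec_simps intro!: exI[of _ "\<lambda>_. 0"])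
    next
      case (incl h)
      then obtain j where "j < ?q" "h = map_vec int (col A j)"
        by (auto simp: cols_def)
      then show ?case
        by (auto intro!: exI[of _ "\<lambda>k. if k = j then 1 else 0"] simp: if_distrib cong: if_cong)
    next
      case (inv h)
      then obtain j where j: "j < ?q" "h = map_vec int (col A j)"
        by (auto simp: cols_def)
      then have "inv\<^bsub>?G\<^esub> h = - h" using \<open>\<And>v. v \<in> carrier_vec ?n \<Longrightarrow> inv\<^bsub>?G\<^esub> v = - v\<close> by simp
      then show ?case using j
        by (auto intro!: exI[of _ "\<lambda>k. if k = j then -1 else 0"] simp: if_distrib cong: if_cong)
    next
      case (eng h1 h2)
      then obtain c1 c2 :: "nat \<Rightarrow> int" where
        "\<forall>i<?n. h1 $ i = (\<Sum>j<?q. int (A $$ (i, j)) * c1 j)"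
        "\<forall>i<?n. h2 $ i = (\<Sum>j<?q. int (A $$ (i, j)) * c2 j)" by blast
      then show ?case using eng
        by (auto simp: monoid_vec_simps distrib_left sum.distrib intro!: exI[of _ "\<lambda>j. c1 j + c2 j"])
    qed
  }
  assume "?R b"
  then obtain c :: "nat \<Rightarrow> int" where b: "b \<in> carrier_vec ?n"
    "\<And>i. i < ?n \<Longrightarrow> b $ i = (\<Sum>j<?q. int (A $$ (i, j)) * c j)" by blast
  have sub: "subgroup (column_lattice A) ?G"
    unfolding column_lattice_def using gens by (intro G.generate_is_subgroup) (simp add: monoid_vec_simps)
  interpret H: subgroup "column_lattice A" ?G by (rule sub)
  \<comment> \<open>Partial sums over the first \<open>k\<close> columns, from the zero vector
    \<open>v 0\<close> to \<open>v ?q = b\<close>.\<close>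
  define v where "v k = vec ?n (\<lambda>i. \<Sum>j<k. int (A $$ (i, j)) * c j)" for k
  have "v k \<in> column_lattice A" if "k \<le> ?q" for k
    using that
  proof (induction k)
    case 0
    have "v 0 = 0\<^sub>v ?n" by (auto simp: v_def)
    then show ?case using H.one_closed by (simp add: monoid_vec_simps)
  next
    case (Suc k)
    let ?h = "map_vec int (col A k)"
    have "?h \<in> column_lattice A"
      unfolding column_lattice_def using Suc.prems by (intro generate.incl) (auto simp: cols_def)
    then have pow: "?h [^]\<^bsub>?G\<^esub> c k \<in> column_lattice A"
      using G.subgroup_int_pow_closed[OF sub] by blast
    have nat_pow: "?h [^]\<^bsub>?G\<^esub> m = vec ?n (\<lambda>i. int (A $$ (i, k)) * int m)" for m :: nat
      by (induction m) (use Suc.prems in \<open>auto simp: monoid_vec_simps algebra_simps intro!: eq_vecI\<close>)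
    have "?h [^]\<^bsub>?G\<^esub> c k = vec ?n (\<lambda>i. int (A $$ (i, k)) * c k)"
    \<comment> \<open>Integer powers reduce to natural ones, which \<open>nat_pow\<close> computes,
      by splitting on the sign of the exponent.\<close>
    proof (cases "c k" rule: int_cases2)
      case (nonneg m)
      then show ?thesis by (simp only: int_pow_int nat_pow)
    next
      case (nonpos m)
      have "?h [^]\<^bsub>?G\<^esub> c k = - vec ?n (\<lambda>i. int (A $$ (i, k)) * int m)"
        unfolding nonpos using Suc.prems
        by (subst G.int_pow_neg) (simp_all only: int_pow_int nat_pow inv vec_carrier, simp add: monoid_vec_simps)
      then show ?thesis unfolding nonpos by (auto intro!: eq_vecI)
    qed
    moreover have "v (Suc k) = v k + vec ?n (\<lambda>i. int (A $$ (i, k)) * c k)"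
      by (auto simp: v_def)
    ultimately show ?case
      using H.m_closed[OF Suc.IH pow] Suc.prems by (simp add: monoid_vec_simps)
  qed
  moreover have "b = v ?q" using b by (auto simp: v_def)
  ultimately show "b \<in> column_lattice A" by simp
qed

text \<open>The \<open>k\<close>-th power of the coset of \<open>a\<close> is the coset of
  \<open>k\<close> times \<open>a\<close>, and a coset is trivial exactly when its representative
  lies in the lattice.\<close>

lemma torsion_free_column_quotient_iff:
  assumes "dim_row A = n"
  shows "torsion_free_group (monoid_vec TYPE(int) n Mod column_lattice A) \<longleftrightarrow>
    (\<forall>a\<in>carrier_vec n. \<forall>k::nat. 0 < k \<and> int k \<cdot>\<^sub>v a \<in> column_lattice A \<longrightarrow> a \<in> column_lattice A)"
proof -
  let ?G = "monoid_vec TYPE(int) n" and ?L = "column_lattice A"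
  interpret G: comm_group ?G by (rule comm_group_vec)
  have "subgroup ?L ?G"
    unfolding column_lattice_def assms
    by (intro G.generate_is_subgroup) (use assms in \<open>auto simp: monoid_vec_simps cols_def\<close>)
  then have "?L \<lhd> ?G" by (rule G.subgroup_imp_normal)
  then interpret N: normal ?L ?G .
  have pow: "a [^]\<^bsub>?G\<^esub> k = int k \<cdot>\<^sub>v a" if "a \<in> carrier_vec n" for a :: "int vec" and k :: nat
    by (induction k) (use that in \<open>auto simp: monoid_vec_simps algebra_simps intro!: eq_vecI\<close>)
  have coset: "?L #>\<^bsub>?G\<^esub> a = ?L \<longleftrightarrow> a \<in> ?L" if "a \<in> carrier_vec n" for a
    using that G.coset_join1[OF _ _ N.is_subgroup, of a] G.coset_join2[OF _ N.is_subgroup, of a]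
    by (auto simp: monoid_vec_simps)
  show ?thesis
    unfolding torsion_free_group_def
    using N.factorgroup_is_group pow coset
    by (auto simp: carrier_FactGroup N.FactGroup_pow monoid_vec_simps)
qed

section \<open>The monoid of column combinations and its algebra\<close>

definition column_monoid :: "nat mat \<Rightarrow> (nat \<Rightarrow>\<^sub>0 nat) set" where
  "column_monoid A = {s. \<exists>y. \<forall>i. Poly_Mapping.lookup s i =
     (if i < dim_row A then \<Sum>j<dim_col A. A $$ (i, j) * y j else 0)}"

definition exponent :: "nat \<Rightarrow> (nat \<Rightarrow> nat) \<Rightarrow> nat \<Rightarrow>\<^sub>0 nat" where
  "exponent n f = (\<Sum>i<n. Poly_Mapping.single i (f i))"

lemma lookup_exponent [simp]: "Poly_Mapping.lookup (exponent n f) i = (if i < n then f i else 0)"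
  by (simp add: exponent_def lookup_sum lookup_single when_def)

lemma monomial_of_eq: "monomial_of v = Poly_Mapping.single (exponent (dim_vec v) (\<lambda>i. v $ i)) 1"
proof -
  have pow: "(mvar i :: (nat \<Rightarrow>\<^sub>0 nat) \<Rightarrow>\<^sub>0 'a) ^ m = Poly_Mapping.single (Poly_Mapping.single i m) 1"
    for i m
    by (induction m) (simp_all add: mvar_def mult_single flip: single_add)
  have "(\<Prod>i<k. mvar i ^ (v $ i)) = Poly_Mapping.single (exponent k (\<lambda>i. v $ i)) (1 :: 'a)" for k
    by (induction k) (simp_all add: exponent_def pow mult_single)
  then show ?thesis by (simp add: monomial_of_def)
qed

lemma add_submonoid_column_monoid: "add_submonoid (column_monoid A)"
proof
  show "0 \<in> column_monoid A"
    by (auto simp: column_monoid_def intro!: exI[of _ "\<lambda>_. 0"])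
next
  fix s t assume "s \<in> column_monoid A" "t \<in> column_monoid A"
  then obtain y z where
    "\<forall>i. Poly_Mapping.lookup s i = (if i < dim_row A then \<Sum>j<dim_col A. A $$ (i, j) * y j else 0)"
    "\<forall>i. Poly_Mapping.lookup t i = (if i < dim_row A then \<Sum>j<dim_col A. A $$ (i, j) * z j else 0)"
    by (auto simp: column_monoid_def)
  then show "s + t \<in> column_monoid A"
    by (auto simp: column_monoid_def lookup_add distrib_left sum.distrib intro!: exI[of _ "\<lambda>j. y j + z j"])
qed

text \<open>One inclusion holds since the monoid algebra contains the generators and constants and
  is closed under sums and products. For the other, each term is a constant times a monomial whose
  exponent is a sum of columns, hence a product of generators.\<close>

lemma subalgebra_generated_monomials:
  "subalgebra_generated (monomial_of ` set (cols A)) =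
    (monoid_algebra (column_monoid A) :: ((nat \<Rightarrow>\<^sub>0 nat) \<Rightarrow>\<^sub>0 'k::comm_ring_1) set)"
    (is "?S = ?R")
proof (intro equalityI subsetI)
  interpret add_submonoid "column_monoid A" by (rule add_submonoid_column_monoid)
  fix p assume "p \<in> ?S"
  then show "p \<in> ?R"
  proof induction
    case (gen f)
    then obtain j where j: "j < dim_col A" "f = monomial_of (col A j)" by (auto simp: cols_def)
    have "exponent (dim_row A) (\<lambda>i. A $$ (i, j)) \<in> column_monoid A"
      using j(1) by (auto simp: column_monoid_def if_distrib cong: if_cong
          intro!: exI[of _ "\<lambda>k. if k = j then 1 else 0"])
    moreover have "f = Poly_Mapping.single (exponent (dim_row A) (\<lambda>i. A $$ (i, j))) 1"
      unfolding j(2) monomial_of_eq using j(1) by (simp add: exponent_def)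
    ultimately show ?case by (simp add: single_mem)
  qed (auto intro: const_mem plus_mem times_mem)
next
  fix p assume p: "p \<in> ?R"
  let ?e = "\<lambda>j. exponent (dim_row A) (\<lambda>i. A $$ (i, j))"
  have one: "1 \<in> ?S" using subalgebra_generated.const[of 1] by simp
  have gen: "Poly_Mapping.single (?e j) 1 \<in> ?S" if "j < dim_col A" for j
  proof -
    have "Poly_Mapping.single (?e j) 1 = (monomial_of (col A j) :: (nat \<Rightarrow>\<^sub>0 nat) \<Rightarrow>\<^sub>0 'k)"
      unfolding monomial_of_eq using that by (simp add: exponent_def)
    also have "\<dots> \<in> ?S"
      using that by (intro subalgebra_generated.gen) (auto simp: cols_def)
    finally show ?thesis .
  qed
  \<comment> \<open>Sums of exponents become products of monomials; an empty or infinite index set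
    gives the monomial 1.\<close>
  have sum: "Poly_Mapping.single (\<Sum>i\<in>I. u i) 1 \<in> ?S"
    if "\<And>i. i \<in> I \<Longrightarrow> Poly_Mapping.single (u i) 1 \<in> ?S" for I :: "nat set" and u
    using that
  proof (induction I rule: infinite_finite_induct)
    case (insert i I)
    have "Poly_Mapping.single (\<Sum>i\<in>insert i I. u i) (1 :: 'k)
        = Poly_Mapping.single (u i) 1 * Poly_Mapping.single (\<Sum>i\<in>I. u i) 1"
      using insert.hyps by (simp add: mult_single)
    then show ?case using insert by (auto intro: subalgebra_generated.mult)
  qed (use one in auto)
  have mono: "Poly_Mapping.single s 1 \<in> ?S" if "s \<in> column_monoid A" for s
  proof -
    from that obtain y where y: "\<forall>i. Poly_Mapping.lookup s i =
        (if i < dim_row A then \<Sum>j<dim_col A. A $$ (i, j) * y j else 0)"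
      by (auto simp: column_monoid_def)
    \<comment> \<open>Column \<open>j\<close> is repeated \<open>y j\<close> times, so that
      \<open>sum\<close> handles both the inner and the outer sum.\<close>
    have "s = (\<Sum>j<dim_col A. \<Sum>k<y j. ?e j)"
      by (rule poly_mapping_eqI) (use y in \<open>simp add: lookup_sum mult.commute del: sum_constant, simp\<close>)
    moreover have "Poly_Mapping.single (\<Sum>j<dim_col A. \<Sum>k<y j. ?e j) 1 \<in> ?S"
      by (intro sum gen) auto
    ultimately show ?thesis by simp
  qed
  have "p = (\<Sum>s\<in>Poly_Mapping.keys p. Poly_Mapping.single 0 (Poly_Mapping.lookup p s) * Poly_Mapping.single s 1)"
    by (rule poly_mapping_eqI) (simp add: lookup_sum mult_single lookup_single when_def in_keys_iff)
  also have "\<dots> \<in> ?S"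
  proof -
    have "(\<Sum>s\<in>I. Poly_Mapping.single 0 (Poly_Mapping.lookup p s) * Poly_Mapping.single s 1) \<in> ?S"
      if "finite I" "I \<subseteq> column_monoid A" for I
      using that
    proof (induction I)
      case empty
      show ?case using subalgebra_generated.const[of 0] by simp
    next
      case (insert s I)
      then show ?case
        by (auto intro!: subalgebra_generated.add subalgebra_generated.mult subalgebra_generated.const mono)
    qed
    then show ?thesis using p by (simp add: monoid_algebra_def)
  qed
  finally show "p \<in> ?S" .
qed

section \<open>Saturation\<close>

text \<open>Dividing \<open>b + m t\<close> by \<open>m\<close> gives points of the cone that tend
  to \<open>t = u - v\<close>, since \<open>b / m\<close> tends to 0. The cone is closed, so it
  contains \<open>t\<close>, and saturation makes the coefficients natural.\<close>

lemma closed_exponent_monoid_if_saturated: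
  assumes col: "\<And>j. j < dim_col A \<Longrightarrow> \<exists>i<dim_row A. A $$ (i, j) \<noteq> 0"
    and sat: "\<And>a. a \<in> carrier_vec (dim_row A) \<Longrightarrow> lp_values A a \<noteq> {} \<Longrightarrow> ip_values A a \<noteq> {}"
  shows "closed_exponent_monoid (column_monoid A) (dim_row A)"
proof -
  interpret add_submonoid "column_monoid A" by (rule add_submonoid_column_monoid)
  let ?n = "dim_row A" and ?q = "dim_col A" and ?S = "column_monoid A"
  show ?thesis
  proof
    fix s assume "s \<in> ?S"
    then show "Poly_Mapping.keys s \<subseteq> {..<?n}"
      by (auto simp: column_monoid_def in_keys_iff split: if_splits)
  next
    fix b u v assume S: "b \<in> ?S" "u \<in> ?S" "v \<in> ?S"
      and "\<And>m::nat. \<exists>w\<in>?S. b + (\<Sum>i<m. u) = (\<Sum>i<m. v) + w"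
    then have "\<exists>y. \<forall>i<?n. int (Poly_Mapping.lookup b i) + int m * int (Poly_Mapping.lookup u i)
        = int m * int (Poly_Mapping.lookup v i) + (\<Sum>j<?q. int (A $$ (i, j)) * int (y j))" for m
    proof -
      obtain w where w: "w \<in> ?S" "b + (\<Sum>i<m. u) = (\<Sum>i<m. v) + w"
        using \<open>\<exists>w\<in>?S. b + (\<Sum>i<m. u) = (\<Sum>i<m. v) + w\<close> by blast
      from w(1) obtain y where y: "\<forall>i. Poly_Mapping.lookup w i =
          (if i < ?n then \<Sum>j<?q. A $$ (i, j) * y j else 0)" by (auto simp: column_monoid_def)
      have "int (Poly_Mapping.lookup b i) + int m * int (Poly_Mapping.lookup u i)
        = int m * int (Poly_Mapping.lookup v i) + int (Poly_Mapping.lookup w i)" for i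
        using arg_cong[OF w(2), of "\<lambda>p. int (Poly_Mapping.lookup p i)"]
        by (simp add: lookup_add lookup_sum del: sum_constant) simp
      then show ?thesis using y by (intro exI[of _ y]) simp
    qed
    then obtain y where y: "\<And>m i. i < ?n \<Longrightarrow>
        int (Poly_Mapping.lookup b i) + int m * int (Poly_Mapping.lookup u i)
        = int m * int (Poly_Mapping.lookup v i) + (\<Sum>j<?q. int (A $$ (i, j)) * int (y m j))" by metis
    define t where "t = vec ?n (\<lambda>i. int (Poly_Mapping.lookup u i) - int (Poly_Mapping.lookup v i))"
    have t: "t \<in> carrier_vec ?n" by (simp add: t_def)
    \<comment> \<open>Starting at \<open>Suc m\<close> avoids division by zero.\<close>
    define Y where "Y m j = real (y (Suc m) j) / real (Suc m)" for m j
    have lim: "(\<lambda>m. \<Sum>j<?q. real (A $$ (i, j)) * Y m j) \<longlonglongrightarrow> real_of_int (t $ i)" if i: "i < ?n" for i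
    proof -
      have "(\<Sum>j<?q. real (A $$ (i, j)) * Y m j)
          = real_of_int (t $ i) + real (Poly_Mapping.lookup b i) * inverse (real (Suc m))" for m
      proof -
        have "real (Suc m) * (\<Sum>j<?q. real (A $$ (i, j)) * Y m j)
            = (\<Sum>j<?q. real (A $$ (i, j)) * real (y (Suc m) j))"
          unfolding sum_distrib_left Y_def by (intro sum.cong) auto
        also have "\<dots> = real (Poly_Mapping.lookup b i) + real (Suc m) * real_of_int (t $ i)"
          using arg_cong[OF y[OF i, of "Suc m"], of real_of_int] i
          by (simp add: t_def algebra_simps)
        finally show ?thesis by (simp add: field_simps del: of_nat_Suc)
      qed
      moreover have "(\<lambda>m. real_of_int (t $ i) + real (Poly_Mapping.lookup b i) * inverse (real (Suc m)))
          \<longlonglongrightarrow> real_of_int (t $ i) + real (Poly_Mapping.lookup b i) * 0"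
        by (intro tendsto_intros LIMSEQ_inverse_real_of_nat)
      ultimately show ?thesis by simp
    qed
    have "0 \<le> Y m j" for m j by (simp add: Y_def)
    then obtain l where l: "\<forall>j<?q. 0 \<le> l j"
      "\<forall>i<?n. (\<Sum>j<?q. real (A $$ (i, j)) * l j) = real_of_int (t $ i)"
      using cone_closed[of ?q Y ?n "\<lambda>i j. A $$ (i, j)" "\<lambda>i. real_of_int (t $ i)", OF _ lim col]
      by blast
    from l have "(\<Sum>j<?q. l j) \<in> lp_values A t" unfolding lp_values_iff[OF t] by blast
    then obtain z where z: "\<And>i. i < ?n \<Longrightarrow> (\<Sum>j<?q. int (A $$ (i, j)) * int (z j)) = t $ i"
      using sat[OF t] ip_values_iff[OF t] by blast
    let ?s = "exponent ?n (\<lambda>i. \<Sum>j<?q. A $$ (i, j) * z j)"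
    have "?s \<in> ?S" by (auto simp: column_monoid_def)
    moreover have "u = v + ?s"
    proof (rule poly_mapping_eqI)
      fix i
      show "Poly_Mapping.lookup u i = Poly_Mapping.lookup (v + ?s) i"
      proof (cases "i < ?n")
        case True
        then have "int (\<Sum>j<?q. A $$ (i, j) * z j) = int (Poly_Mapping.lookup u i) - int (Poly_Mapping.lookup v i)"
          using z[OF True] by (simp add: t_def)
        then show ?thesis using True by (simp add: lookup_add del: of_nat_sum)
      next
        case False
        then show ?thesis using S(2,3) by (auto simp: column_monoid_def lookup_add)
      qed
    qed
    ultimately show "\<exists>s\<in>?S. u = v + s" by blast
  qed
qed

text \<open>The vector \<open>a\<close> has rational coefficients \<open>c j / k\<close>, possibly
  negative. Adding \<open>N\<close> times every column makes them nonnegative, saturation then gives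
  natural coefficients, and subtracting \<open>N\<close> leaves integral ones.\<close>

lemma torsion_free_if_saturated:
  assumes sat: "\<And>a. a \<in> carrier_vec (dim_row A) \<Longrightarrow> lp_values A a \<noteq> {} \<Longrightarrow> ip_values A a \<noteq> {}"
    and a: "a \<in> carrier_vec (dim_row A)" and k: "0 < k" "int k \<cdot>\<^sub>v a \<in> column_lattice A"
  shows "a \<in> column_lattice A"
proof -
  let ?n = "dim_row A" and ?q = "dim_col A"
  from k(2) obtain c :: "nat \<Rightarrow> int" where
    "\<forall>i<?n. (int k \<cdot>\<^sub>v a) $ i = (\<Sum>j<?q. int (A $$ (i, j)) * c j)"
    unfolding column_lattice_iff by blast
  then have c: "int k * a $ i = (\<Sum>j<?q. int (A $$ (i, j)) * c j)" if "i < ?n" for i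
    using a that by simp
  \<comment> \<open>Large enough that \<open>c j / k + N\<close> is nonnegative for every
    column.\<close>
  define N where "N = (\<Sum>j<?q. \<bar>c j\<bar>)"
  define b where "b = vec ?n (\<lambda>i. a $ i + (\<Sum>j<?q. int (A $$ (i, j)) * N))"
  have b: "b \<in> carrier_vec ?n" by (simp add: b_def)
  define y where "y j = real_of_int (c j) / real k + real_of_int N" for j
  have "0 \<le> y j" if "j < ?q" for j
  proof -
    have "\<bar>c j\<bar> \<le> N" unfolding N_def using that by (intro member_le_sum) auto
    moreover have "\<bar>real_of_int (c j) / real k\<bar> \<le> \<bar>real_of_int (c j)\<bar>"
      using k(1) by (simp add: abs_divide divide_le_eq mult_le_cancel_left1)
    ultimately show ?thesis unfolding y_def by linarith
  qed
  moreover have "(\<Sum>j<?q. real (A $$ (i, j)) * y j) = real_of_int (b $ i)" if i: "i < ?n" for i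
  proof -
    have "real k * real_of_int (a $ i) = (\<Sum>j<?q. real (A $$ (i, j)) * real_of_int (c j))"
      using arg_cong[OF c[OF i], of real_of_int] by simp
    then have "real_of_int (a $ i) = (\<Sum>j<?q. real (A $$ (i, j)) * (real_of_int (c j) / real k))"
      using k(1) by (simp add: eq_divide_eq mult.commute flip: sum_divide_distrib)
    then show ?thesis
      using i by (simp add: b_def y_def distrib_left sum.distrib)
  qed
  ultimately have "(\<Sum>j<?q. y j) \<in> lp_values A b" unfolding lp_values_iff[OF b] by blast
  then obtain z where z: "\<And>i. i < ?n \<Longrightarrow> (\<Sum>j<?q. int (A $$ (i, j)) * int (z j)) = b $ i"
    using sat[OF b] ip_values_iff[OF b] by blast
  have "a $ i = (\<Sum>j<?q. int (A $$ (i, j)) * (int (z j) - N))" if "i < ?n" for i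
    using z[OF that] that by (simp add: b_def right_diff_distrib sum_subtractf)
  then show ?thesis
    unfolding column_lattice_iff using a by (auto intro!: exI[of _ "\<lambda>j. int (z j) - N"])
qed

text \<open>The monomial \<open>x^s\<close> is the fraction \<open>x^p / x^m\<close> and a root of
  the monic polynomial \<open>T^k - x^(k s)\<close> over the algebra. Normality puts it into the
  algebra, so its only exponent \<open>s\<close> lies in \<open>S\<close>.\<close>

lemma single_mem_if_power_mem:
  fixes p m s :: "'a::{ordered_cancel_comm_monoid_add, linorder}" and k :: nat
  assumes "add_submonoid S"
    and normal: "normal_subring (monoid_algebra S :: ('a \<Rightarrow>\<^sub>0 'k::field) set)"
    and S: "p \<in> S" "m \<in> S" "p = m + s" and k: "0 < k" "(\<Sum>i<k. s) \<in> S"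
  shows "s \<in> S"
proof -
  interpret add_submonoid S by fact
  let ?R = "monoid_algebra S :: ('a \<Rightarrow>\<^sub>0 'k) set"
  let ?x = "\<lambda>s. Poly_Mapping.single s (1 :: 'k)"
  have "?x p = ?x m * ?x s" using S(3) by (simp add: mult_single)
  moreover have nz: "?x m \<noteq> 0" by (metis lookup_single_eq lookup_zero zero_neq_one)
  ultimately have "to_fract (?x s) = Fract (?x p) (?x m)"
    by (simp add: to_fract_def eq_fract mult.commute)
  then have frac: "to_fract (?x s) \<in> fraction_field_of ?R"
    using S nz single_mem unfolding fraction_field_of_def by blast
  have pow: "?x s ^ i = ?x (\<Sum>l<i. s)" for i
    by (induction i) (simp_all add: mult_single add.commute del: sum_constant)
  let ?P = "monom 1 k - [:to_fract (?x (\<Sum>i<k. s)):]"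
  \<comment> \<open>\<open>0 < k\<close> keeps the constant term apart from the leading coefficient
    1.\<close>
  have coeff: "coeff ?P i = (if i = k then 1 else if i = 0 then - to_fract (?x (\<Sum>i<k. s)) else 0)" for i
    using k(1) by (auto simp: coeff_pCons split: nat.split)
  have "degree ?P = k"
    using k(1) by (intro antisym degree_le le_degree) (auto simp: coeff simp del: coeff_diff)
  moreover have "coeff ?P i \<in> to_fract ` ?R" for i
  proof -
    have "to_fract 1 \<in> to_fract ` ?R" "to_fract 0 \<in> to_fract ` ?R"
      "to_fract (- ?x (\<Sum>i<k. s)) \<in> to_fract ` ?R"
      using one_mem const_mem[of 0] k(2) by (intro imageI uminus_mem single_mem; simp)+
    then show ?thesis unfolding coeff by simp
  qed
  moreover have "poly ?P (to_fract (?x s)) = 0"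
    by (simp add: poly_monom pow flip: to_fract_power del: sum_constant)
  ultimately have "integral_over (to_fract ` ?R) (to_fract (?x s))"
    unfolding integral_over_def by (intro exI[of _ ?P]) (simp add: coeff del: coeff_diff)
  then have "?x s \<in> ?R"
    using normal frac unfolding normal_subring_def by fastforce
  then show ?thesis by (simp add: monoid_algebra_def)
qed

text \<open>A positive multiple of \<open>a\<close> is a natural combination of the columns, so
  torsion-freeness makes \<open>a\<close> an integral one. Splitting its coefficients by sign writes
  \<open>a\<close> as a difference of monoid elements, as \<open>single_mem_if_power_mem\<close>
  requires.\<close>

lemma saturated_if_normal_torsion_free:
  assumes normal: "normal_subring (monoid_algebra (column_monoid A) :: ((nat \<Rightarrow>\<^sub>0 nat) \<Rightarrow>\<^sub>0 'k::field) set)"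
    and tf: "\<And>a k. a \<in> carrier_vec (dim_row A) \<Longrightarrow> 0 < k \<Longrightarrow> int k \<cdot>\<^sub>v a \<in> column_lattice A \<Longrightarrow>
      a \<in> column_lattice A"
    and a: "a \<in> carrier_vec (dim_row A)" and "lp_values A a \<noteq> {}"
  shows "ip_values A a \<noteq> {}"
proof -
  let ?n = "dim_row A" and ?q = "dim_col A" and ?S = "column_monoid A"
  from assms(4) obtain y where y: "\<And>j. j < ?q \<Longrightarrow> 0 \<le> y j"
    "\<And>i. i < ?n \<Longrightarrow> (\<Sum>j<?q. real (A $$ (i, j)) * y j) = real_of_int (a $ i)"
    using lp_values_iff[OF a] by blast
  obtain k w where k: "0 < k"
    "\<And>i. i < ?n \<Longrightarrow> (\<Sum>j<?q. int (A $$ (i, j)) * int (w j)) = int k * a $ i"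
    using multiple_in_column_monoid[of ?q y ?n "\<lambda>i j. A $$ (i, j)" "\<lambda>i. a $ i", OF y] by blast
  have "int k \<cdot>\<^sub>v a \<in> column_lattice A"
    unfolding column_lattice_iff using a k(2) by (auto intro!: exI[of _ "\<lambda>j. int (w j)"])
  then have "a \<in> column_lattice A" using tf a k(1) by blast
  then obtain c :: "nat \<Rightarrow> int" where
    c: "\<And>i. i < ?n \<Longrightarrow> a $ i = (\<Sum>j<?q. int (A $$ (i, j)) * c j)"
    unfolding column_lattice_iff by blast
  \<comment> \<open>Makes \<open>nat (a $ i)\<close> a faithful natural exponent for
    \<open>a\<close>.\<close>
  have a_nonneg: "0 \<le> a $ i" if "i < ?n" for i
  proof -
    have "0 \<le> int k * a $ i" unfolding k(2)[OF that, symmetric] by (intro sum_nonneg) auto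
    then show ?thesis using k(1) by (simp add: zero_le_mult_iff)
  qed
  let ?e = "\<lambda>f. exponent ?n (\<lambda>i. \<Sum>j<?q. A $$ (i, j) * f j)"
  let ?s = "exponent ?n (\<lambda>i. nat (a $ i))"
  have e_mem: "?e f \<in> ?S" for f by (auto simp: column_monoid_def)
  \<comment> \<open>Positive and negative parts of \<open>c\<close>: moving the negative part to the
    other side keeps all exponents natural.\<close>
  have "?e (\<lambda>j. nat (c j)) = ?e (\<lambda>j. nat (- c j)) + ?s"
  proof (rule poly_mapping_eqI)
    fix i
    have "(\<Sum>j<?q. A $$ (i, j) * nat (c j)) = (\<Sum>j<?q. A $$ (i, j) * nat (- c j)) + nat (a $ i)"
      if "i < ?n"
    proof -
      have "int (nat (c j)) - int (nat (- c j)) = c j" for j by linarith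
      then have "(\<Sum>j<?q. int (A $$ (i, j)) * int (nat (c j))) - (\<Sum>j<?q. int (A $$ (i, j)) * int (nat (- c j)))
          = (\<Sum>j<?q. int (A $$ (i, j)) * c j)"
        by (simp flip: sum_subtractf right_diff_distrib)
      then have "int (\<Sum>j<?q. A $$ (i, j) * nat (c j))
          = int ((\<Sum>j<?q. A $$ (i, j) * nat (- c j)) + nat (a $ i))"
        using c[OF that] a_nonneg[OF that] by simp
      then show ?thesis by (simp only: of_nat_eq_iff)
    qed
    then show "Poly_Mapping.lookup (?e (\<lambda>j. nat (c j))) i = Poly_Mapping.lookup (?e (\<lambda>j. nat (- c j)) + ?s) i"
      by (simp add: lookup_add)
  qed
  moreover have "(\<Sum>i<k. ?s) = ?e w"
  proof (rule poly_mapping_eqI)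
    fix i
    have "int (\<Sum>j<?q. A $$ (i, j) * w j) = int (k * nat (a $ i))" if "i < ?n"
      using k(2)[OF that] a_nonneg[OF that] by simp
    then show "Poly_Mapping.lookup (\<Sum>i<k. ?s) i = Poly_Mapping.lookup (?e w) i"
      by (simp add: lookup_sum del: sum_constant of_nat_sum of_nat_mult) simp
  qed
  then have "(\<Sum>i<k. ?s) \<in> ?S" by (simp only: e_mem)
  ultimately have "?s \<in> ?S"
    by (rule single_mem_if_power_mem[OF add_submonoid_column_monoid normal
          e_mem[of "\<lambda>j. nat (c j)"] e_mem[of "\<lambda>j. nat (- c j)"] _ k(1)])
  then obtain z where z: "\<And>i. Poly_Mapping.lookup ?s i = (if i < ?n then \<Sum>j<?q. A $$ (i, j) * z j else 0)"
    unfolding column_monoid_def by blast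
  have "(\<Sum>j<?q. int (A $$ (i, j)) * int (z j)) = a $ i" if "i < ?n" for i
    using arg_cong[OF z[of i], of int] that a_nonneg[OF that] by simp
  then have "(\<Sum>j<?q. int (z j)) \<in> ip_values A a" unfolding ip_values_iff[OF a] by blast
  then show ?thesis by blast
qed

text \<open>Adding up all rows equates \<open>d\<close> times the objective with the entry sum of
  \<open>a\<close>, so \<open>a\<close> determines the value once \<open>d > 0\<close>.\<close>

lemma lp_values_constant:
  assumes a: "a \<in> carrier_vec (dim_row A)"
    and col: "\<And>j. j < dim_col A \<Longrightarrow> \<exists>i<dim_row A. A $$ (i, j) \<noteq> 0"
    and d: "\<And>j. j < dim_col A \<Longrightarrow> (\<Sum>i<dim_row A. int (A $$ (i, j))) = d"
    and x: "x \<in> lp_values A a" "x' \<in> lp_values A a"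
  shows "x = x'"
\<comment> \<open>Without columns \<open>d\<close> is arbitrary, but the objective is the empty sum;
  otherwise a nonzero column makes \<open>d\<close> positive.\<close>
proof (cases "dim_col A = 0")
  case True
  then show ?thesis using x by (simp add: lp_values_iff[OF a])
next
  case False
  then have q: "0 < dim_col A" by simp
  from col[OF this] obtain i where i: "i < dim_row A" "A $$ (i, 0) \<noteq> 0" by blast
  have "int (A $$ (i, 0)) \<le> (\<Sum>i<dim_row A. int (A $$ (i, 0)))"
    using i by (intro member_le_sum) auto
  with d[OF q] i(2) have "d > 0" by simp
  have "real_of_int d * x = (\<Sum>i<dim_row A. real_of_int (a $ i))" if x: "x \<in> lp_values A a" for x
  proof -
    from x obtain y where y:
      "\<And>i. i < dim_row A \<Longrightarrow> (\<Sum>j<dim_col A. real (A $$ (i, j)) * y j) = real_of_int (a $ i)"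
      "x = (\<Sum>j<dim_col A. y j)" unfolding lp_values_iff[OF a] by blast
    have "(\<Sum>i<dim_row A. real_of_int (a $ i)) = (\<Sum>i<dim_row A. \<Sum>j<dim_col A. real (A $$ (i, j)) * y j)"
      using y(1) by simp
    also have "\<dots> = (\<Sum>j<dim_col A. (\<Sum>i<dim_row A. real (A $$ (i, j))) * y j)"
      by (subst sum.swap) (simp add: sum_distrib_right)
    also have "\<dots> = (\<Sum>j<dim_col A. real_of_int d * y j)"
    proof (rule sum.cong)
      fix j assume "j \<in> {..<dim_col A}"
      then have "real_of_int (\<Sum>i<dim_row A. int (A $$ (i, j))) = real_of_int d" using d by simp
      then show "(\<Sum>i<dim_row A. real (A $$ (i, j))) * y j = real_of_int d * y j" by simp
    qed simp
    finally show ?thesis by (simp add: y(2) sum_distrib_left)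
  qed
  then have "real_of_int d * x = real_of_int d * x'" using x by simp
  then show ?thesis using \<open>d > 0\<close> by simp
qed

text \<open>Integral values are also values of the linear program, which all equal \<open>m\<close>.
  As saturation provides an integral value, \<open>m\<close> is an integer and the only element of
  \<open>ip_values A a\<close>.\<close>

lemma rounding_if_saturated:
  assumes sat: "\<And>a. a \<in> carrier_vec (dim_row A) \<Longrightarrow> lp_values A a \<noteq> {} \<Longrightarrow> ip_values A a \<noteq> {}"
    and "\<And>j. j < dim_col A \<Longrightarrow> \<exists>i<dim_row A. A $$ (i, j) \<noteq> 0"
    and "\<And>j. j < dim_col A \<Longrightarrow> (\<Sum>i<dim_row A. int (A $$ (i, j))) = d"
  shows "integer_rounding_property A"
  unfolding integer_rounding_property_def
proof (intro ballI allI impI)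
  fix a m assume a: "a \<in> carrier_vec (dim_row A)" and "is_minimum (lp_values A a) m"
  then have m: "m \<in> lp_values A a" by (simp add: is_minimum_def)
  have "x = \<lceil>m\<rceil>" if "x \<in> ip_values A a" for x
    using lp_values_constant[OF a assms(2,3) lp_value_if_ip_value[OF a that] m] by linarith
  moreover obtain x where "x \<in> ip_values A a" using sat[OF a] m by blast
  ultimately show "is_minimum (ip_values A a) \<lceil>m\<rceil>" by (auto simp: is_minimum_def)
qed

theorem theorem1p2p20:
  fixes A :: "nat mat" and n q :: nat
    and KF :: "((nat \<Rightarrow>\<^sub>0 nat) \<Rightarrow>\<^sub>0 'k::field) set"
  assumes "A \<in> carrier_mat n q"
    and "\<And>i. i < n \<Longrightarrow> row A i \<noteq> 0\<^sub>v q"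
    and "\<And>j. j < q \<Longrightarrow> col A j \<noteq> 0\<^sub>v n"
    and "KF = subalgebra_generated (monomial_of ` set (cols A))"
  shows "(integer_rounding_property A \<longrightarrow>
            normal_subring KF \<and>
            torsion_free_group (monoid_vec TYPE(int) n Mod column_lattice A))
       \<and> ((\<exists>d::int. \<forall>v \<in> set (cols A). int (v \<bullet> ones_vec n) = d) \<and>
            normal_subring KF \<and>
            torsion_free_group (monoid_vec TYPE(int) n Mod column_lattice A) \<longrightarrow>
          integer_rounding_property A)"
proof -
  have dim: "dim_row A = n" "dim_col A = q" using assms(1) by auto
  have KF: "KF = monoid_algebra (column_monoid A)"
    using assms(4) by (simp add: subalgebra_generated_monomials)
  note tf = torsion_free_column_quotient_iff[OF dim(1)]
  have col: "\<exists>i<dim_row A. A $$ (i, j) \<noteq> 0" if "j < dim_col A" for j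
    using assms(3)[of j] that dim by (auto intro!: eq_vecI)
  have "normal_subring KF \<and> torsion_free_group (monoid_vec TYPE(int) n Mod column_lattice A)"
    if irp: "integer_rounding_property A"
  proof
    \<comment> \<open>Saturation, on which both conclusions rest.\<close>
    note sat = ip_feasible_if_rounding[OF irp _ _ col]
    show "normal_subring KF"
      unfolding KF
      by (rule closed_exponent_monoid.normal_monoid_algebra[OF closed_exponent_monoid_if_saturated[OF col sat]])
    show "torsion_free_group (monoid_vec TYPE(int) n Mod column_lattice A)"
      unfolding tf using torsion_free_if_saturated[OF sat] dim by blast
  qed
  moreover have "integer_rounding_property A"
    if d: "\<forall>v \<in> set (cols A). int (v \<bullet> ones_vec n) = d" and normal: "normal_subring KF"
      and "torsion_free_group (monoid_vec TYPE(int) n Mod column_lattice A)" for d :: int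
  proof (rule rounding_if_saturated)
    show "ip_values A a \<noteq> {}" if "a \<in> carrier_vec (dim_row A)" "lp_values A a \<noteq> {}" for a
      using saturated_if_normal_torsion_free[OF normal[unfolded KF] _ that] \<open>torsion_free_group _\<close>
      unfolding tf dim by blast
    show "(\<Sum>i<dim_row A. int (A $$ (i, j))) = d" if "j < dim_col A" for j
    proof -
      have "int (col A j \<bullet> ones_vec n) = d" using d that by (auto simp: cols_def)
      then show ?thesis
        using that dim by (simp add: scalar_prod_def ones_vec_def lessThan_atLeast0)
    qed
  qed (rule col)
  ultimately show ?thesis by blast
qed

end
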